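(* Let $n \ge 1$, let $T = e_1T_1 + e_2T_2 \in L_1^n \times_e L_1^n$, and let $I = e_1 I + e_2 I \in L_1^n\times_e L_1^n$ be the identity operator. Then a bicomplex number $\kappa = \kappa_1e_1+\kappa_2e_2$ (with $\kappa_1,\kappa_2\in\mathbb{C}_1$) is a modified eigenvalue of $T$ if and only if $T-\kappa I$ is singular.
   Context: $\mathbb{C}_1$ denotes the complex numbers with imaginary unit $i_1$. The bicomplex numbers are $\mathbb{C}_2=\{z_1+i_2z_2 : z_1,z_2\in\mathbb{C}_1\}$, a commutative $\mathbb{C}_1$-algebra with $i_1^2=i_2^2=-1$, $i_1i_2=i_2i_1$. Put $e_1=(1+i_1i_2)/2$ and $e_2=(1-i_1i_2)/2$; these are idempotents with $e_1+e_2=1$, $e_1e_2=0$. Every $\xi=z_1+i_2z_2\in\mathbb{C}_2$ is uniquely $\xi=\xi^-e_1+\xi^+e_2$ with $\xi^-=z_1-i_1z_2$, $\xi^+=z_1+i_1z_2\in\mathbb{C}_1$. $\mathbb{C}_2^n$ is regarded as a vector space over $\mathbb{C}_1$; bicomplex scalars act on it componentwise. $L_1^n$ is the set of $\mathbb{C}_1$-linear operators $\mathbb{C}_1^n\to\mathbb{C}_1^n$. For $T_1,T_2\in L_1^n$, $T=e_1T_1+e_2T_2$ is the $\mathbb{C}_1$-linear operator on $\mathbb{C}_2^n$ given by $T(\xi_1,\dots,\xi_n)=e_1T_1(\xi_1^-,\dots,\xi_n^-)+e_2T_2(\xi_1^+,\dots,\xi_n^+)$, and $L_1^n\times_eL_1^n$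 is the set of all such operators. For $\eta=\eta^-e_1+\eta^+e_2\in\mathbb{C}_2$, $\eta T:=e_1(\eta^-T_1)+e_2(\eta^+T_2)$; in particular $\eta I=e_1(\eta^-I)+e_2(\eta^+I)$. A linear operator is singular if its kernel is not $\{0\}$. A scalar $\kappa\in\mathbb{C}_2$ is a modified eigenvalue of $T$ if there is a nonzero $x\in\mathbb{C}_2^n$ with $T(x)=\kappa x$. *)

theory Defs
  imports "HOL-Analysis.Analysis"
begin

text \<open>
  \<^term>\<open>Bicomplex z1 z2\<close> encodes $z_1 + i_2 z_2$, where the type \<^typ>\<open>complex\<close> plays
  the role of $\mathbb{C}_1$ and its imaginary unit \<^term>\<open>\<i>\<close> that of $i_1$.
\<close>

datatype bicomplex = Bicomplex (bc_fst: complex) (bc_snd: complex)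

lemma bicomplex_eq_iff: "x = y \<longleftrightarrow> bc_fst x = bc_fst y \<and> bc_snd x = bc_snd y"
  by (cases x; cases y) auto

instantiation bicomplex :: comm_ring_1
begin

definition "0 = Bicomplex 0 0"
definition "1 = Bicomplex 1 0"
definition "- x = Bicomplex (- bc_fst x) (- bc_snd x)"
definition "x + y = Bicomplex (bc_fst x + bc_fst y) (bc_snd x + bc_snd y)"
definition "x - y = Bicomplex (bc_fst x - bc_fst y) (bc_snd x - bc_snd y)"
definition "x * y = Bicomplex (bc_fst x * bc_fst y - bc_snd x * bc_snd y)
                              (bc_fst x * bc_snd y + bc_snd x * bc_fst y)"

lemmas bicomplex_defs =
  zero_bicomplex_def one_bicomplex_def uminus_bicomplex_def
  plus_bicomplex_def minus_bicomplex_def times_bicomplex_def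

instance
  by standard (auto simp: bicomplex_defs bicomplex_eq_iff algebra_simps)

end

definition bc_of_complex :: "complex \<Rightarrow> bicomplex" where
  "bc_of_complex z = Bicomplex z 0"

definition bc_i1 :: bicomplex where "bc_i1 = bc_of_complex \<i>"
definition bc_i2 :: bicomplex where "bc_i2 = Bicomplex 0 1"

definition bc_e1 :: bicomplex where "bc_e1 = bc_of_complex (1/2) * (1 + bc_i1 * bc_i2)"
definition bc_e2 :: bicomplex where "bc_e2 = bc_of_complex (1/2) * (1 - bc_i1 * bc_i2)"

definition bc_minus :: "bicomplex \<Rightarrow> complex" where
  "bc_minus \<xi> = bc_fst \<xi> - \<i> * bc_snd \<xi>"

definition bc_plus :: "bicomplex \<Rightarrow> complex" where
  "bc_plus \<xi> = bc_fst \<xi> + \<i> * bc_snd \<xi>"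

lemma bc_e1_eq: "bc_e1 = Bicomplex (1/2) (\<i>/2)"
  and bc_e2_eq: "bc_e2 = Bicomplex (1/2) (-\<i>/2)"
  by (simp_all add: bc_e1_def bc_e2_def bc_i1_def bc_i2_def bc_of_complex_def bicomplex_defs)

lemma bc_idempotent_decomposition:
  "\<xi> = bc_of_complex a * bc_e1 + bc_of_complex b * bc_e2 \<longleftrightarrow> a = bc_minus \<xi> \<and> b = bc_plus \<xi>"
proof -
  have "bc_minus (bc_of_complex a * bc_e1 + bc_of_complex b * bc_e2) = a"
    and "bc_plus (bc_of_complex a * bc_e1 + bc_of_complex b * bc_e2) = b"
    by (simp_all add: bc_minus_def bc_plus_def bc_e1_eq bc_e2_eq bc_of_complex_def bicomplex_defs
        algebra_simps)
  moreover have "\<xi> = bc_of_complex (bc_minus \<xi>) * bc_e1 + bc_of_complex (bc_plus \<xi>) * bc_e2"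
    by (simp add: bc_minus_def bc_plus_def bc_e1_eq bc_e2_eq bc_of_complex_def bicomplex_defs
        bicomplex_eq_iff field_simps)
  ultimately show ?thesis by metis
qed

definition bc_minus_vec :: "bicomplex ^ 'n \<Rightarrow> complex ^ 'n" where
  "bc_minus_vec x = (\<chi> i. bc_minus (x $ i))"

definition bc_plus_vec :: "bicomplex ^ 'n \<Rightarrow> complex ^ 'n" where
  "bc_plus_vec x = (\<chi> i. bc_plus (x $ i))"

definition bc_vec_of_complex :: "complex ^ 'n \<Rightarrow> bicomplex ^ 'n" where
  "bc_vec_of_complex v = (\<chi> i. bc_of_complex (v $ i))"

definition L1 :: "(complex ^ 'n \<Rightarrow> complex ^ 'n) set" where
  "L1 = {T. Vector_Spaces.linear (*s) (*s) T}"

text \<open>The operator $e_1 T_1 + e_2 T_2$ on $\mathbb{C}_2^n$.\<close>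

definition e_op ::
  "(complex ^ 'n \<Rightarrow> complex ^ 'n) \<Rightarrow> (complex ^ 'n \<Rightarrow> complex ^ 'n) \<Rightarrow>
   bicomplex ^ 'n \<Rightarrow> bicomplex ^ 'n" where
  "e_op T1 T2 x = bc_e1 *s bc_vec_of_complex (T1 (bc_minus_vec x))
                + bc_e2 *s bc_vec_of_complex (T2 (bc_plus_vec x))"

text \<open>
  \<^term>\<open>e_scale \<eta> T1 T2\<close> is $\eta T$ for $T = e_1 T_1 + e_2 T_2$. It takes the two components
  rather than $T$ because the product is defined through them.
\<close>

definition e_scale ::
  "bicomplex \<Rightarrow> (complex ^ 'n \<Rightarrow> complex ^ 'n) \<Rightarrow> (complex ^ 'n \<Rightarrow> complex ^ 'n) \<Rightarrow>
   bicomplex ^ 'n \<Rightarrow> bicomplex ^ 'n" where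
  "e_scale \<eta> T1 T2 = e_op (\<lambda>v. bc_minus \<eta> *s T1 v) (\<lambda>v. bc_plus \<eta> *s T2 v)"

definition singular_op :: "(bicomplex ^ 'n \<Rightarrow> bicomplex ^ 'n) \<Rightarrow> bool" where
  "singular_op T \<longleftrightarrow> {x. T x = 0} \<noteq> {0}"

definition modified_eigenvalue :: "(bicomplex ^ 'n \<Rightarrow> bicomplex ^ 'n) \<Rightarrow> bicomplex \<Rightarrow> bool" where
  "modified_eigenvalue T \<kappa> \<longleftrightarrow> (\<exists>x. x \<noteq> 0 \<and> T x = \<kappa> *s x)"

end

theory Submission
  imports Defs
begin

text \<open>
  The formal product \<^term>\<open>e_scale \<kappa> id id\<close> is built from the idempotent components of
  \<open>\<kappa>\<close> and of the vector. Since \<open>e\<^sub>1\<close> and \<open>e\<^sub>2\<close> are orthogonal idempotents, the components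
  of a product of bicomplex numbers are the products of the components, so this operator is just
  multiplication by \<open>\<kappa>\<close> (lemma \<open>e_scale_id\<close>). Hence the kernel of \<open>T - \<kappa>I\<close> consists of the
  \<open>x\<close> with \<open>T x = \<kappa> x\<close>. By linearity of \<open>T\<^sub>1\<close> and \<open>T\<^sub>2\<close> this kernel contains
  \<open>0\<close> (lemma \<open>e_op_zero\<close>), so it differs from \<open>{0}\<close> precisely when it has a nonzero element,
  that is, when \<open>\<kappa>\<close> is a modified eigenvalue.
\<close>

lemma e_op_component:
  "e_op T1 T2 x $ i = bc_of_complex (T1 (bc_minus_vec x) $ i) * bc_e1
                    + bc_of_complex (T2 (bc_plus_vec x) $ i) * bc_e2"
  by (simp add: e_op_def bc_vec_of_complex_def mult.commute)

lemma bc_minus_mult: "bc_minus (x * y) = bc_minus x * bc_minus y"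
  by (simp add: bc_minus_def bicomplex_defs algebra_simps)

lemma bc_plus_mult: "bc_plus (x * y) = bc_plus x * bc_plus y"
  by (simp add: bc_plus_def bicomplex_defs algebra_simps)

text \<open>
  In each coordinate the left-hand side is the idempotent decomposition with components
  \<open>\<eta>\<^sup>- \<xi>\<^sup>-\<close> and \<open>\<eta>\<^sup>+ \<xi>\<^sup>+\<close>; as the two component maps are multiplicative, uniqueness of that
  decomposition identifies it with \<open>\<eta> \<xi>\<close>.
\<close>

lemma e_scale_id: "e_scale \<eta> id id x = \<eta> *s x"
proof -
  have "(\<eta> *s x) $ i = e_scale \<eta> id id x $ i" for i
    by (simp add: e_scale_def e_op_component bc_idempotent_decomposition
        bc_minus_vec_def bc_plus_vec_def bc_minus_mult bc_plus_mult)
  then show ?thesis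
    by (simp add: vec_eq_iff)
qed

lemma L1_zero: "S \<in> L1 \<Longrightarrow> S 0 = 0"
  unfolding L1_def
  using module_hom.zero[OF Vector_Spaces.linear.axioms(3)] by blast

lemma e_op_zero:
  fixes T1 T2 :: "complex ^ 'n \<Rightarrow> complex ^ 'n"
  assumes "T1 \<in> L1" and "T2 \<in> L1"
  shows "e_op T1 T2 0 = 0"
proof -
  have "bc_minus_vec 0 = (0 :: complex ^ 'n)" and "bc_plus_vec 0 = (0 :: complex ^ 'n)"
    by (simp_all add: bc_minus_vec_def bc_plus_vec_def bc_minus_def bc_plus_def
        zero_bicomplex_def vec_eq_iff)
  moreover have "bc_of_complex 0 = 0"
    by (simp add: bc_of_complex_def zero_bicomplex_def)
  ultimately have "e_op T1 T2 0 $ i = 0" for i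
    by (simp add: e_op_component L1_zero[OF assms(1)] L1_zero[OF assms(2)])
  then show ?thesis
    by (simp add: vec_eq_iff)
qed

theorem theorem3p1:
  fixes T1 T2 :: "complex ^ 'n \<Rightarrow> complex ^ 'n"
    and T :: "bicomplex ^ 'n \<Rightarrow> bicomplex ^ 'n"
    and \<kappa> :: bicomplex and \<kappa>1 \<kappa>2 :: complex
  assumes "T1 \<in> L1" and "T2 \<in> L1" and "T = e_op T1 T2"
    and "\<kappa> = bc_of_complex \<kappa>1 * bc_e1 + bc_of_complex \<kappa>2 * bc_e2"
  shows "modified_eigenvalue T \<kappa> \<longleftrightarrow> singular_op (\<lambda>x. T x - e_scale \<kappa> id id x)"
proof -
  have "T 0 = \<kappa> *s 0"
    using e_op_zero[OF assms(1,2)] assms(3) by simp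
  then have "(\<exists>x. x \<noteq> 0 \<and> T x = \<kappa> *s x) \<longleftrightarrow> {x. T x = \<kappa> *s x} \<noteq> {0}"
    by blast
  then show ?thesis
    by (simp add: modified_eigenvalue_def singular_op_def e_scale_id)
qed

end
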